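(* Let $O$ be a Cayley algebra over a field $F$ of characteristic $\neq2$ and let $A\subseteq\operatorname{im}(O)$ be a three-dimensional associative subspace, i.e. $(xy)z=x(yz)$ for all $x,y,z\in A$. Then $F1\oplus A$ is closed under the multiplication of $O$, and hence is a 4-dimensional associative subalgebra of $O$.
   Context: Cayley algebra: $D_\gamma(D_\beta(D_\alpha(F)))$, $\alpha,\beta,\gamma\in F^\times$, with $D_\gamma(A)=A\oplus A$ (elements $a+ib$), $(a+ib)(c+id)=(ac+\gamma db^* )+i(a^*d+cb)$, $(a+ib)^*=a^*-ib$, starting from $F$ with identity involution; $\operatorname{im}(O)=\{a:a^*=-a\}$. *)

theory Defs
  imports Main "HOL-Library.Product_Plus"
begin

text \<open>Cayley--Dickson doubling D_g(A) = A \<oplus> A, with elements (a,b) standing for a + ib: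
  (a+ib)(c+id) = (ac + g d b^*) + i(a^* d + c b),   (a+ib)^* = a^* - ib.
  The parameters mul, cnj, sc are the multiplication, involution and scalar action of A.\<close>

fun cd_mul :: "('b \<Rightarrow> 'b \<Rightarrow> 'b) \<Rightarrow> ('b \<Rightarrow> 'b) \<Rightarrow> ('a \<Rightarrow> 'b \<Rightarrow> 'b) \<Rightarrow> 'a
     \<Rightarrow> ('b::ab_group_add) \<times> 'b \<Rightarrow> 'b \<times> 'b \<Rightarrow> 'b \<times> 'b" where
  "cd_mul mul cnj sc g (a, b) (c, d) =
     (mul a c + sc g (mul d (cnj b)), mul (cnj a) d + mul c b)"

fun cd_cnj :: "('b \<Rightarrow> 'b) \<Rightarrow> ('b::ab_group_add) \<times> 'b \<Rightarrow> 'b \<times> 'b" where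
  "cd_cnj cnj (a, b) = (cnj a, - b)"

fun cd_sc :: "('a \<Rightarrow> 'b \<Rightarrow> 'b) \<Rightarrow> 'a \<Rightarrow> 'b \<times> 'b \<Rightarrow> 'b \<times> 'b" where
  "cd_sc sc k (a, b) = (sc k a, sc k b)"

definition mul1 :: "'a::field \<Rightarrow> 'a \<times> 'a \<Rightarrow> 'a \<times> 'a \<Rightarrow> 'a \<times> 'a" where
  "mul1 \<alpha> = cd_mul (*) id (*) \<alpha>"
definition cnj1 :: "'a::field \<times> 'a \<Rightarrow> 'a \<times> 'a" where
  "cnj1 = cd_cnj id"
definition sc1 :: "'a::field \<Rightarrow> 'a \<times> 'a \<Rightarrow> 'a \<times> 'a" where
  "sc1 = cd_sc (*)"

type_synonym 'a quat = "('a \<times> 'a) \<times> ('a \<times> 'a)"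
definition mul2 :: "'a::field \<Rightarrow> 'a \<Rightarrow> 'a quat \<Rightarrow> 'a quat \<Rightarrow> 'a quat" where
  "mul2 \<alpha> \<beta> = cd_mul (mul1 \<alpha>) cnj1 sc1 \<beta>"
definition cnj2 :: "'a::field quat \<Rightarrow> 'a quat" where
  "cnj2 = cd_cnj cnj1"
definition sc2 :: "'a::field \<Rightarrow> 'a quat \<Rightarrow> 'a quat" where
  "sc2 = cd_sc sc1"

type_synonym 'a oct = "'a quat \<times> 'a quat"
definition oct_mul :: "'a::field \<Rightarrow> 'a \<Rightarrow> 'a \<Rightarrow> 'a oct \<Rightarrow> 'a oct \<Rightarrow> 'a oct" where
  "oct_mul \<alpha> \<beta> \<gamma> = cd_mul (mul2 \<alpha> \<beta>) cnj2 sc2 \<gamma>"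
definition oct_cnj :: "'a::field oct \<Rightarrow> 'a oct" where
  "oct_cnj = cd_cnj cnj2"
definition oct_sc :: "'a::field \<Rightarrow> 'a oct \<Rightarrow> 'a oct" where
  "oct_sc = cd_sc sc2"
definition oct_one :: "'a::field oct" where
  "oct_one = (((1, 0), (0, 0)), ((0, 0), (0, 0)))"

definition oct_im :: "'a::field oct set" where
  "oct_im = {a. oct_cnj a = - a}"

definition oct_dim3_subspace :: "'a::field oct set \<Rightarrow> bool" where
  "oct_dim3_subspace A \<longleftrightarrow>
     (\<exists>x1 x2 x3.
        A = {oct_sc a x1 + oct_sc b x2 + oct_sc c x3 | a b c. True} \<and>
        (\<forall>a b c. oct_sc a x1 + oct_sc b x2 + oct_sc c x3 = 0 \<longrightarrow> a = 0 \<and> b = 0 \<and> c = 0))"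

end

theory Submission
  imports Defs
begin

text \<open>
  Write \<open>\<langle>x, y\<rangle> = - Re (x y)\<close> and \<open>w = x y + \<langle>x, y\<rangle>\<close> for imaginary \<open>x, y\<close>. If \<open>w\<close> lies in the
  span of \<open>x, y\<close> there is nothing to show for the product \<open>x y\<close>. Otherwise nondegeneracy of the
  form gives an imaginary \<open>p\<close> orthogonal to \<open>x\<close> and \<open>y\<close> but not to \<open>w\<close>, and the linearised
  alternative law yields
  \<open>2 \<langle>p, w\<rangle> z = (y x) (p z) - x (y (p z)) - p [x, y, z]\<close>.
  The element \<open>(y x) q - x (y q)\<close> lies in the span of \<open>1, x, y, w\<close> for every \<open>q\<close>. So if all
  associators vanish on \<open>A\<close>, then \<open>A\<close> is contained in the span of \<open>x, y, w\<close>, and comparing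
  dimensions gives \<open>w \<in> A\<close>. The argument is insensitive to whether the form degenerates on \<open>A\<close>.
\<close>

section \<open>Coordinates, real parts and scalars\<close>

lemma cd_mul_proj:
  "cd_mul mul cnj sc g u v =
     (mul (fst u) (fst v) + sc g (mul (snd v) (cnj (snd u))),
      mul (cnj (fst u)) (snd v) + mul (fst v) (snd u))"
  by (cases u; cases v) simp

lemma cd_cnj_proj: "cd_cnj cnj u = (cnj (fst u), - snd u)"
  by (cases u) simp

lemma cd_sc_proj: "cd_sc sc k u = (sc k (fst u), sc k (snd u))"
  by (cases u) simp

lemmas oct_proj =
  oct_mul_def mul2_def mul1_def oct_cnj_def cnj2_def cnj1_def oct_sc_def sc2_def sc1_def
  oct_one_def cd_mul_proj cd_cnj_proj cd_sc_proj

definition oct_re :: "'a::field oct \<Rightarrow> 'a" where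
  "oct_re x = fst (fst (fst x))"

text \<open>Conjugation fixes the first coordinate and negates the other seven, so only
  \<open>a = - a\<close> in the first coordinate is a condition.\<close>

lemma oct_im_iff:
  assumes "(2::'a::field) \<noteq> 0"
  shows "(x :: 'a oct) \<in> oct_im \<longleftrightarrow> oct_re x = 0"
proof -
  have "a = - a \<longleftrightarrow> a = 0" for a :: 'a
    using assms by (metis add.inverse_neutral add_eq_0_iff mult_2 mult_eq_0_iff)
  then show ?thesis
    by (simp add: oct_im_def oct_re_def oct_proj prod_eq_iff)
qed

lemma oct_re_linear [simp]:
  "oct_re (x + y) = oct_re x + oct_re y"
  "oct_re (x - y) = oct_re x - oct_re y"
  "oct_re (- x) = - oct_re x"
  "oct_re (oct_sc t x) = t * oct_re x"
  "oct_re oct_one = 1"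
  by (simp_all add: oct_re_def oct_proj)

lemma oct_imaginary_coordinates:
  assumes "oct_re x = 0"
  obtains x1 x2 x3 x4 x5 x6 x7 where "x = (((0, x1), (x2, x3)), ((x4, x5), (x6, x7)))"
  using assms that unfolding oct_re_def by (metis prod.collapse)

lemma oct_sc_algebra:
  "oct_sc s (x + y) = oct_sc s x + oct_sc s y"
  "oct_sc s (x - y) = oct_sc s x - oct_sc s y"
  "oct_sc (s + t) x = oct_sc s x + oct_sc t x"
  "oct_sc (s - t) x = oct_sc s x - oct_sc t x"
  "oct_sc s (oct_sc t x) = oct_sc (s * t) x"
  "oct_sc (- s) x = - oct_sc s x"
  by (simp_all add: oct_proj prod_eq_iff algebra_simps)

lemma oct_sc_unit [simp]:
  "oct_sc 0 x = 0" "oct_sc s 0 = 0" "oct_sc 1 x = x"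
  by (simp_all add: oct_proj prod_eq_iff)

section \<open>The bilinear form and the alternative law\<close>

context
  fixes \<alpha> \<beta> \<gamma> :: "'a::field"
begin

abbreviation (input) mult :: "'a oct \<Rightarrow> 'a oct \<Rightarrow> 'a oct"  (infixl "\<bullet>" 70) where
  "x \<bullet> y \<equiv> oct_mul \<alpha> \<beta> \<gamma> x y"

text \<open>For imaginary \<open>x\<close> the value \<open>form x x\<close> is the norm, the
  product of \<open>x\<close> with its conjugate.\<close>

definition form :: "'a oct \<Rightarrow> 'a oct \<Rightarrow> 'a" where
  "form x y = - oct_re (x \<bullet> y)"

definition cross :: "'a oct \<Rightarrow> 'a oct \<Rightarrow> 'a oct" where
  "cross x y = x \<bullet> y + oct_sc (form x y) oct_one"

lemma mult_bilinear:
  "(x + y) \<bullet> z = x \<bullet> z + y \<bullet> z"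
  "z \<bullet> (x + y) = z \<bullet> x + z \<bullet> y"
  "z \<bullet> (x - y) = z \<bullet> x - z \<bullet> y"
  "oct_sc t x \<bullet> z = oct_sc t (x \<bullet> z)"
  "z \<bullet> oct_sc t x = oct_sc t (z \<bullet> x)"
  "(x - y) \<bullet> z = x \<bullet> z - y \<bullet> z"
  "(- x) \<bullet> z = - (x \<bullet> z)"
  by (simp_all add: oct_proj prod_eq_iff algebra_simps)

lemma mult_one [simp]: "oct_one \<bullet> x = x" "x \<bullet> oct_one = x"
  by (simp_all add: oct_proj prod_eq_iff)

lemma mult_zero [simp]: "x \<bullet> 0 = 0"
  by (simp add: oct_proj prod_eq_iff)

lemma form_linear:
  "form z (x + y) = form z x + form z y"
  "form z (x - y) = form z x - form z y"
  "form z (oct_sc t x) = t * form z x"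
  by (simp_all add: form_def mult_bilinear)

lemma oct_re_cross [simp]: "oct_re (cross x y) = 0"
  by (simp add: cross_def form_def)

lemma form_commute: "form x y = form y x"
  by (simp add: form_def oct_re_def oct_proj algebra_simps)

text \<open>Polarisation of
  \<open>x \<bullet> (x \<bullet> z) = (x \<bullet> x) \<bullet> z\<close>, where an imaginary
  square is a scalar. This is a Clifford relation: left multiplications by orthogonal imaginary
  elements anticommute.\<close>

lemma left_alternative_linearised:
  assumes "oct_re x = 0" "oct_re y = 0"
  shows "x \<bullet> (y \<bullet> z) + y \<bullet> (x \<bullet> z) = oct_sc (- 2 * form x y) z"
proof -
  obtain x1 x2 x3 x4 x5 x6 x7 where x: "x = (((0, x1), (x2, x3)), ((x4, x5), (x6, x7)))"
    using assms(1) by (rule oct_imaginary_coordinates)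
  obtain y1 y2 y3 y4 y5 y6 y7 where y: "y = (((0, y1), (y2, y3)), ((y4, y5), (y6, y7)))"
    using assms(2) by (rule oct_imaginary_coordinates)
  obtain z0 z1 z2 z3 z4 z5 z6 z7 where z: "z = (((z0, z1), (z2, z3)), ((z4, z5), (z6, z7)))"
    by (metis prod.collapse)
  show ?thesis
    unfolding x y z
    by (simp add: form_def oct_re_def oct_proj; intro conjI; algebra)
qed

text \<open>The swapped factors are explained by doubling. If \<open>x\<close> and \<open>y\<close>
  generate a quaternion subalgebra H with O = H + iH, then a(id) = i(a^* d) and (yx)^* = x^* y^*, so
  the difference vanishes for \<open>q\<close> in iH, and for \<open>q\<close> in H it stays in H.
  The coordinate identity also covers degenerate pairs.\<close>

lemma twisted_associator:
  assumes "oct_re x = 0" "oct_re y = 0"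
  shows "(y \<bullet> x) \<bullet> q - x \<bullet> (y \<bullet> q) =
    oct_sc (2 * form (cross x y) q) oct_one + oct_sc (2 * form y q) x
    + oct_sc (- 2 * form x q) y + oct_sc (- 2 * oct_re q) (cross x y)"
proof -
  obtain x1 x2 x3 x4 x5 x6 x7 where x: "x = (((0, x1), (x2, x3)), ((x4, x5), (x6, x7)))"
    using assms(1) by (rule oct_imaginary_coordinates)
  obtain y1 y2 y3 y4 y5 y6 y7 where y: "y = (((0, y1), (y2, y3)), ((y4, y5), (y6, y7)))"
    using assms(2) by (rule oct_imaginary_coordinates)
  obtain q0 q1 q2 q3 q4 q5 q6 q7 where q: "q = (((q0, q1), (q2, q3)), ((q4, q5), (q6, q7)))"
    by (metis prod.collapse)
  show ?thesis
    unfolding x y q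
    by (simp add: cross_def form_def oct_re_def oct_proj; intro conjI; algebra)
qed

lemma mult_swap:
  assumes "oct_re x = 0" "oct_re y = 0"
  shows "y \<bullet> x = - cross x y - oct_sc (form x y) oct_one"
  using assms
  by (simp add: cross_def form_def oct_re_def oct_proj prod_eq_iff algebra_simps)

section \<open>Nondegeneracy and separation\<close>

text \<open>The form is diagonal on the seven imaginary basis units, and each diagonal entry is up
  to sign a product of some of \<alpha>, \<beta>, \<gamma>.\<close>

lemma form_nondegenerate:
  assumes nz: "\<alpha> \<noteq> 0" "\<beta> \<noteq> 0" "\<gamma> \<noteq> 0"
    and re: "oct_re x = 0"
    and orth: "\<And>p. oct_re p = 0 \<Longrightarrow> form x p = 0"
  shows "x = 0"
  using re nz
    orth[of "(((0,1),(0,0)),((0,0),(0,0)))"]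
    orth[of "(((0,0),(1,0)),((0,0),(0,0)))"]
    orth[of "(((0,0),(0,1)),((0,0),(0,0)))"]
    orth[of "(((0,0),(0,0)),((1,0),(0,0)))"]
    orth[of "(((0,0),(0,0)),((0,1),(0,0)))"]
    orth[of "(((0,0),(0,0)),((0,0),(1,0)))"]
    orth[of "(((0,0),(0,0)),((0,0),(0,1)))"]
  by (simp add: form_def oct_re_def oct_proj prod_eq_iff)

text \<open>Subtracting a suitable multiple of a \<open>u\<close> with \<open>f u \<noteq> 0\<close>
  moves any \<open>v\<close> into the kernel of \<open>f\<close>. Subspace and linearity enter only
  through combinations \<open>v - oct_sc t u\<close>.\<close>

lemma functional_multiple:
  fixes f h :: "'a oct \<Rightarrow> 'a"
  assumes K: "\<And>u v t. u \<in> K \<Longrightarrow> v \<in> K \<Longrightarrow> v - oct_sc t u \<in> K"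
    and f: "\<And>u v t. f (v - oct_sc t u) = f v - t * f u"
    and h: "\<And>u v t. h (v - oct_sc t u) = h v - t * h u"
    and ker: "\<And>v. v \<in> K \<Longrightarrow> f v = 0 \<Longrightarrow> h v = 0"
  shows "\<exists>c. \<forall>v\<in>K. h v = c * f v"
proof (cases "\<exists>u\<in>K. f u \<noteq> 0")
  case True
  then obtain u where u: "u \<in> K" "f u \<noteq> 0" by blast
  have "h v = h u / f u * f v" if "v \<in> K" for v
  proof -
    have "f (v - oct_sc (f v / f u) u) = 0"
      using u by (simp add: f)
    then have "h (v - oct_sc (f v / f u) u) = 0"
      using ker K u that by blast
    then show ?thesis
      by (simp add: h)
  qed
  then show ?thesis by blast
next
  case False
  then show ?thesis using ker by auto
qed

text \<open>Without such a \<open>p\<close>, the functional \<open>form w\<close> would vanish on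
  the common kernel of \<open>form x\<close> and \<open>form y\<close>, hence be a combination of
  them, and nondegeneracy would put \<open>w\<close> in their span.\<close>

lemma orthogonal_separation:
  assumes nz: "\<alpha> \<noteq> 0" "\<beta> \<noteq> 0" "\<gamma> \<noteq> 0"
    and re: "oct_re x = 0" "oct_re y = 0" "oct_re w = 0"
    and w: "\<And>a b. w \<noteq> oct_sc a x + oct_sc b y"
  obtains p where "oct_re p = 0" "form p x = 0" "form p y = 0" "form p w \<noteq> 0"
proof (rule ccontr)
  assume "\<not> thesis"
  then have ker: "form w p = 0" if "oct_re p = 0" "form x p = 0" "form y p = 0" for p
    using that \<open>\<And>p. oct_re p = 0 \<Longrightarrow> form p x = 0 \<Longrightarrow> form p y = 0 \<Longrightarrow> form p w \<noteq> 0 \<Longrightarrow> thesis\<close>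
    by (metis form_commute)
  \<comment> \<open>Within the kernel of \<open>form x\<close>, \<open>form w\<close> vanishes
    wherever \<open>form y\<close> does; this fixes the coefficient of \<open>y\<close>.\<close>
  have "\<exists>b. \<forall>p\<in>{p. oct_re p = 0 \<and> form x p = 0}. form w p = b * form y p"
    by (rule functional_multiple) (auto simp: form_linear ker)
  then obtain b where b: "form w p = b * form y p" if "oct_re p = 0" "form x p = 0" for p
    by blast
  \<comment> \<open>The remainder vanishes on the kernel of \<open>form x\<close>, which fixes the
    coefficient of \<open>x\<close>.\<close>
  have "\<exists>a. \<forall>p\<in>{p. oct_re p = 0}. form w p - b * form y p = a * form x p"
    by (rule functional_multiple) (auto simp: form_linear b algebra_simps)
  then obtain a where a: "form w p - b * form y p = a * form x p" if "oct_re p = 0" for p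
    by blast
  have "w - (oct_sc a x + oct_sc b y) = 0"
  proof (rule form_nondegenerate[OF nz])
    fix p :: "'a oct"
    assume "oct_re p = 0"
    then show "form (w - (oct_sc a x + oct_sc b y)) p = 0"
      using a[of p] by (simp add: form_commute[of _ p] form_linear algebra_simps)
  qed (simp add: re)
  then show False using w[of a b] by simp
qed

section \<open>Elements associating with two imaginary vectors\<close>

text \<open>Since \<open>z\<close> associates with \<open>x\<close> and \<open>y\<close>,
  multiplying it by \<open>cross x y\<close> amounts to applying \<open>y\<close>, then
  \<open>x\<close>, plus a scalar. Left multiplication by \<open>p\<close> commutes with that
  composite, but passing \<open>p\<close> across \<open>cross x y\<close> by the Clifford relation
  leaves a multiple of \<open>z\<close>. Equating the two isolates \<open>z\<close>.\<close>

lemma associator_eliminates: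
  assumes re: "oct_re x = 0" "oct_re y = 0" "oct_re p = 0"
    and orth: "form p x = 0" "form p y = 0"
    and assoc: "(x \<bullet> y) \<bullet> z = x \<bullet> (y \<bullet> z)"
  shows "oct_sc (2 * form p (cross x y)) z = (y \<bullet> x) \<bullet> (p \<bullet> z) - x \<bullet> (y \<bullet> (p \<bullet> z))"
proof -
  let ?w = "cross x y" and ?s = "oct_sc (form x y)"
  have anti: "p \<bullet> (u \<bullet> v) = - (u \<bullet> (p \<bullet> v))" if "oct_re u = 0" "form p u = 0" for u v
    using left_alternative_linearised[of p u v] re that by (simp add: eq_neg_iff_add_eq_0)
  \<comment> \<open>Moving \<open>p\<close> past \<open>x\<close> and then past \<open>y\<close>
    changes the sign twice.\<close>
  have "p \<bullet> (x \<bullet> (y \<bullet> z)) = - (x \<bullet> (p \<bullet> (y \<bullet> z)))"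
    by (rule anti) (use re orth in auto)
  also have "\<dots> = x \<bullet> (y \<bullet> (p \<bullet> z))"
    using anti[OF re(2) orth(2), of z] mult_bilinear(3)[of x 0] by simp
  finally have 1: "p \<bullet> (x \<bullet> (y \<bullet> z)) = x \<bullet> (y \<bullet> (p \<bullet> z))" .
  have xy: "?w \<bullet> z = (x \<bullet> y) \<bullet> z + ?s z"
    by (simp add: cross_def mult_bilinear)
  have "?w \<bullet> (p \<bullet> z) + oct_sc (2 * form p ?w) z = - (p \<bullet> (?w \<bullet> z))"
    using left_alternative_linearised[OF re(3) oct_re_cross, of x y z]
    by (simp add: oct_sc_algebra algebra_simps eq_neg_iff_add_eq_0)
  also have "p \<bullet> (?w \<bullet> z) = x \<bullet> (y \<bullet> (p \<bullet> z)) + ?s (p \<bullet> z)"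
    by (simp add: xy assoc mult_bilinear 1)
  finally have "oct_sc (2 * form p ?w) z = - (?w \<bullet> (p \<bullet> z)) - ?s (p \<bullet> z) - x \<bullet> (y \<bullet> (p \<bullet> z))"
    by (simp add: eq_neg_iff_add_eq_0 algebra_simps)
  also have "- (?w \<bullet> (p \<bullet> z)) - ?s (p \<bullet> z) = (y \<bullet> x) \<bullet> (p \<bullet> z)"
    by (simp add: mult_swap[OF re(1,2)] mult_bilinear)
  finally show ?thesis .
qed

text \<open>Taking \<open>q = p \<bullet> z\<close> in \<open>twisted_associator\<close> puts a
  nonzero multiple of \<open>z\<close> in the span of \<open>1, x, y, cross x y\<close>; comparing
  real parts removes the component along \<open>1\<close>.\<close>

lemma associating_in_span:
  assumes two: "(2::'a) \<noteq> 0"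
    and re: "oct_re x = 0" "oct_re y = 0" "oct_re p = 0" "oct_re z = 0"
    and orth: "form p x = 0" "form p y = 0" and p: "form p (cross x y) \<noteq> 0"
    and assoc: "(x \<bullet> y) \<bullet> z = x \<bullet> (y \<bullet> z)"
  shows "\<exists>a b c. z = oct_sc a x + oct_sc b y + oct_sc c (cross x y)"
proof -
  let ?k = "2 * form p (cross x y)"
  have k: "?k \<noteq> 0" using two p by simp
  have "\<exists>t a b c. oct_sc ?k z =
      oct_sc t oct_one + oct_sc a x + oct_sc b y + oct_sc c (cross x y)"
    unfolding associator_eliminates[OF re(1-3) orth assoc] twisted_associator[OF re(1,2)]
    by blast
  then obtain t a b c where
    *: "oct_sc ?k z = oct_sc t oct_one + oct_sc a x + oct_sc b y + oct_sc c (cross x y)"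
    by blast
  have "t = 0"
    using arg_cong[OF *, of oct_re] re by simp
  then have "oct_sc (1 / ?k) (oct_sc ?k z) =
      oct_sc (a / ?k) x + oct_sc (b / ?k) y + oct_sc (c / ?k) (cross x y)"
    unfolding * by (simp add: oct_sc_algebra)
  moreover have "oct_sc (1 / ?k) (oct_sc ?k z) = z"
    using k by (simp add: oct_sc_algebra)
  ultimately show ?thesis by metis
qed

end

section \<open>Dimension count and closure\<close>

lemma three_vectors_in_plane_dependent:
  fixes x y x1 x2 x3 :: "'a::field oct"
  assumes indep: "\<And>a b c. oct_sc a x1 + oct_sc b x2 + oct_sc c x3 = 0 \<Longrightarrow> a = 0 \<and> b = 0 \<and> c = 0"
    and span: "x1 = oct_sc a1 x + oct_sc b1 y" "x2 = oct_sc a2 x + oct_sc b2 y"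
      "x3 = oct_sc a3 x + oct_sc b3 y"
  shows False
proof -
  have comb: "oct_sc a x1 + oct_sc b x2 + oct_sc c x3 =
      oct_sc (a * a1 + b * a2 + c * a3) x + oct_sc (a * b1 + b * b2 + c * b3) y" for a b c
    by (simp add: span oct_sc_algebra algebra_simps)
  \<comment> \<open>The three minors of the coefficient matrix form a vector orthogonal to both rows
    \<open>(a1, a2, a3)\<close> and \<open>(b1, b2, b3)\<close>, hence give a linear
    relation.\<close>
  have "a1 * b2 - a2 * b1 = 0"
    using indep[of "a2 * b3 - a3 * b2" "a3 * b1 - a1 * b3" "a1 * b2 - a2 * b1"]
    unfolding comb by (simp add: algebra_simps)
  \<comment> \<open>With this minor zero, \<open>(b2, - b1, 0)\<close> and
    \<open>(a2, - a1, 0)\<close> are relations too, and then \<open>x1 = 0\<close>.\<close>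
  then have "b1 = 0" "a1 = 0"
    using indep[of b2 "- b1" 0] indep[of a2 "- a1" 0] unfolding comb by (simp_all add: algebra_simps)
  then show False
    using indep[of 1 0 0] span by simp
qed

theorem mainTheorem16:
  fixes \<alpha> \<beta> \<gamma> :: "'a::field" and A :: "'a oct set"
  assumes "(2::'a) \<noteq> 0"
    and "\<alpha> \<noteq> 0" and "\<beta> \<noteq> 0" and "\<gamma> \<noteq> 0"
    and "oct_dim3_subspace A"
    and "A \<subseteq> oct_im"
    and "\<forall>x\<in>A. \<forall>y\<in>A. \<forall>z\<in>A.
           oct_mul \<alpha> \<beta> \<gamma> (oct_mul \<alpha> \<beta> \<gamma> x y) z = oct_mul \<alpha> \<beta> \<gamma> x (oct_mul \<alpha> \<beta> \<gamma> y z)"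
  defines "B \<equiv> {oct_sc t oct_one + x | t x. x \<in> A}"
  shows "(\<forall>u\<in>B. \<forall>v\<in>B. oct_mul \<alpha> \<beta> \<gamma> u v \<in> B)
       \<and> (\<forall>x\<in>B. \<forall>y\<in>B. \<forall>z\<in>B.
           oct_mul \<alpha> \<beta> \<gamma> (oct_mul \<alpha> \<beta> \<gamma> x y) z = oct_mul \<alpha> \<beta> \<gamma> x (oct_mul \<alpha> \<beta> \<gamma> y z))
       \<and> (\<forall>t. oct_sc t oct_one \<in> A \<longrightarrow> t = 0)"
proof -
  obtain x1 x2 x3 where
    A: "A = {oct_sc a x1 + oct_sc b x2 + oct_sc c x3 | a b c. True}" and
    indep: "\<And>a b c. oct_sc a x1 + oct_sc b x2 + oct_sc c x3 = 0 \<Longrightarrow> a = 0 \<and> b = 0 \<and> c = 0"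
    using assms(5) unfolding oct_dim3_subspace_def by (elim exE conjE) (rule that, assumption, blast)
  have A_add: "x + y \<in> A" if xy: "x \<in> A" "y \<in> A" for x y
  proof -
    obtain a b c a' b' c' where "x = oct_sc a x1 + oct_sc b x2 + oct_sc c x3"
      "y = oct_sc a' x1 + oct_sc b' x2 + oct_sc c' x3"
      using xy A by blast
    then have "x + y = oct_sc (a + a') x1 + oct_sc (b + b') x2 + oct_sc (c + c') x3"
      by (simp add: oct_sc_algebra)
    then show ?thesis using A by blast
  qed
  have A_sc: "oct_sc t x \<in> A" if x: "x \<in> A" for t x
  proof -
    obtain a b c where "x = oct_sc a x1 + oct_sc b x2 + oct_sc c x3"
      using x A by blast
    then have "oct_sc t x = oct_sc (t * a) x1 + oct_sc (t * b) x2 + oct_sc (t * c) x3"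
      by (simp add: oct_sc_algebra)
    then show ?thesis using A by blast
  qed
  have "x1 = oct_sc 1 x1 + oct_sc 0 x2 + oct_sc 0 x3" "x2 = oct_sc 0 x1 + oct_sc 1 x2 + oct_sc 0 x3"
    "x3 = oct_sc 0 x1 + oct_sc 0 x2 + oct_sc 1 x3"
    by simp_all
  then have xs: "x1 \<in> A" "x2 \<in> A" "x3 \<in> A"
    unfolding A by blast+
  have re: "oct_re x = 0" if "x \<in> A" for x
    using that assms(6) oct_im_iff[OF assms(1)] by blast
  have cross_A: "cross \<alpha> \<beta> \<gamma> x y \<in> A" if xy: "x \<in> A" "y \<in> A" for x y
  \<comment> \<open>The first case includes linearly dependent \<open>x\<close> and
    \<open>y\<close>; in the second a separating \<open>p\<close> exists.\<close>
  proof (cases "\<exists>a b. cross \<alpha> \<beta> \<gamma> x y = oct_sc a x + oct_sc b y")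
    case True
    then show ?thesis using A_add A_sc xy by metis
  next
    case False
    let ?w = "cross \<alpha> \<beta> \<gamma> x y"
    obtain p where p: "oct_re p = 0" "form \<alpha> \<beta> \<gamma> p x = 0" "form \<alpha> \<beta> \<gamma> p y = 0"
      "form \<alpha> \<beta> \<gamma> p ?w \<noteq> 0"
      using orthogonal_separation[OF assms(2-4) re[OF xy(1)] re[OF xy(2)] oct_re_cross] False
      by blast
    have span: "\<exists>a b c. z = oct_sc a x + oct_sc b y + oct_sc c ?w" if "z \<in> A" for z
      by (rule associating_in_span[OF assms(1) _ _ p(1) _ p(2-4)])
        (use re xy that assms(7) in auto)
    \<comment> \<open>Three independent vectors do not fit in the span of \<open>x\<close> and
      \<open>y\<close>, so some \<open>z\<close> in \<open>A\<close> has a nonzero coefficient at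
      \<open>?w\<close>, and \<open>?w\<close> can be solved for inside \<open>A\<close>.\<close>
    have "\<exists>z\<in>A. \<not> (\<exists>a b. z = oct_sc a x + oct_sc b y)"
    proof (rule ccontr)
      assume "\<not> ?thesis"
      then obtain a1 b1 a2 b2 a3 b3 where "x1 = oct_sc a1 x + oct_sc b1 y"
        "x2 = oct_sc a2 x + oct_sc b2 y" "x3 = oct_sc a3 x + oct_sc b3 y"
        using xs by metis
      then show False
        by (rule three_vectors_in_plane_dependent[rotated]) (erule indep)
    qed
    then obtain z a b c where z: "z \<in> A" "z = oct_sc a x + oct_sc b y + oct_sc c ?w"
      and nz: "\<not> (\<exists>a b. z = oct_sc a x + oct_sc b y)"
      using span by blast
    have "c \<noteq> 0" using z(2) nz by (metis add.right_neutral oct_sc_unit(1))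
    have "oct_sc c ?w = z + (oct_sc (- a) x + oct_sc (- b) y)"
      by (simp add: z(2) oct_sc_algebra)
    then have "oct_sc c ?w \<in> A"
      using A_add[OF z(1) A_add[OF A_sc[OF xy(1)] A_sc[OF xy(2)]]] by simp
    then have "oct_sc (1 / c) (oct_sc c ?w) \<in> A"
      by (rule A_sc)
    then show ?thesis
      using \<open>c \<noteq> 0\<close> by (simp add: oct_sc_algebra)
  qed
  have closed: "oct_mul \<alpha> \<beta> \<gamma> u v \<in> B" if uv: "u \<in> B" "v \<in> B" for u v
  proof -
    obtain s x t y where u: "u = oct_sc s oct_one + x" "x \<in> A"
      and v: "v = oct_sc t oct_one + y" "y \<in> A"
      using uv unfolding B_def by blast
    \<comment> \<open>Split into real and imaginary part; the only product of elements of
      \<open>A\<close> left in the latter is the cross product.\<close>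
    have "oct_mul \<alpha> \<beta> \<gamma> u v = oct_sc (s * t - form \<alpha> \<beta> \<gamma> x y) oct_one
        + (oct_sc s y + oct_sc t x + cross \<alpha> \<beta> \<gamma> x y)"
      by (simp add: u v cross_def mult_bilinear oct_sc_algebra algebra_simps)
    moreover have "oct_sc s y + oct_sc t x + cross \<alpha> \<beta> \<gamma> x y \<in> A"
      by (intro A_add A_sc cross_A u v)
    ultimately show ?thesis unfolding B_def by blast
  qed
  \<comment> \<open>The associator is trilinear and vanishes when one argument is
    \<open>oct_one\<close>, so only the components in \<open>A\<close> matter.\<close>
  have assoc: "oct_mul \<alpha> \<beta> \<gamma> (oct_mul \<alpha> \<beta> \<gamma> u v) w = oct_mul \<alpha> \<beta> \<gamma> u (oct_mul \<alpha> \<beta> \<gamma> v w)"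
    if uvw: "u \<in> B" "v \<in> B" "w \<in> B" for u v w
  proof -
    obtain s x t y r z where "u = oct_sc s oct_one + x" "v = oct_sc t oct_one + y"
      "w = oct_sc r oct_one + z" "x \<in> A" "y \<in> A" "z \<in> A"
      using uvw unfolding B_def by blast
    moreover from this have "oct_mul \<alpha> \<beta> \<gamma> (oct_mul \<alpha> \<beta> \<gamma> x y) z =
        oct_mul \<alpha> \<beta> \<gamma> x (oct_mul \<alpha> \<beta> \<gamma> y z)"
      using assms(7) by blast
    ultimately show ?thesis
      by (simp add: mult_bilinear oct_sc_algebra algebra_simps)
  qed
  have one: "t = 0" if "oct_sc t oct_one \<in> A" for t
    using re[OF that] by simp
  show ?thesis
    by (intro conjI ballI allI impI closed assoc one)
qed

end
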